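(* Let $\Lambda>0$, let the base station (BS) locations form a homogeneous Poisson point process in $\mathbb{R}^2$ of intensity $\Lambda$, and for each integer $k\geq 1$ let $R_k$ be the Euclidean distance from the origin to the $k$-th nearest BS. Then for every integer $k\geq 1$ the random variable $\Lambda\pi R_k^2$ follows the gamma distribution with shape parameter $k$ and scale parameter $1$, i.e. $\Lambda\pi R_k^2\sim\Gamma(k,1)$.
   Context: A mobile user is located at the origin of the plane. The BSs are the points of a homogeneous Poisson point process $\Phi$ in $\mathbb{R}^2$ with intensity $\Lambda>0$ (the BS density); in particular the probability that exactly $n$ BSs lie within distance $r$ of the origin is $\frac{(\Lambda\pi r^2)^n}{n!}e^{-\Lambda\pi r^2}$. Almost surely the points of $\Phi$ have distinct distances to the origin, and $R_1<R_2<\cdots$ denote these distances listed in increasing order, so that $R_k$ is the distance from the origin to the $k$-th nearest BS. The gamma distribution $\Gamma(k,1)$ with shape $k$ and scale $1$ is the distribution on $[0,\infty)$ with density $\frac{y^{k-1}}{(k-1)!}e^{-y}$. *)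

theory Defs
  imports "HOL-Probability.Probability"
begin

text \<open>
  A simple point process is a random set \<open>\<Phi>\<close> of points, finite in every bounded region. The
  probabilities of the counts are written out explicitly, because \<^const>\<open>poisson_pmf\<close> is only
  specified for positive rates and \<open>B\<close> may be a null set.
\<close>

locale poisson_point_process = prob_space M
  for M :: "'w measure" and \<Phi> :: "'w \<Rightarrow> 'a::euclidean_space set" and \<Lambda> :: real +
  assumes intensity_pos: "\<Lambda> > 0"
    and locally_finite: "\<And>\<omega> B. \<omega> \<in> space M \<Longrightarrow> bounded B \<Longrightarrow> finite (\<Phi> \<omega> \<inter> B)"
    and count_measurable: "\<And>B. B \<in> sets borel \<Longrightarrow> bounded B \<Longrightarrow>
      (\<lambda>\<omega>. card (\<Phi> \<omega> \<inter> B)) \<in> measurable M (count_space UNIV)"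
    and count_poisson: "\<And>B n. B \<in> sets borel \<Longrightarrow> bounded B \<Longrightarrow>
      prob {\<omega> \<in> space M. card (\<Phi> \<omega> \<inter> B) = n} =
        (\<Lambda> * measure lborel B) ^ n / fact n * exp (- (\<Lambda> * measure lborel B))"
    and count_indep: "\<And>\<B>. finite \<B> \<Longrightarrow> disjoint \<B> \<Longrightarrow> (\<And>B. B \<in> \<B> \<Longrightarrow> B \<in> sets borel \<and> bounded B) \<Longrightarrow>
      indep_vars (\<lambda>_. count_space UNIV) (\<lambda>B \<omega>. card (\<Phi> \<omega> \<inter> B)) \<B>"

text \<open>
  The distances from the origin to the points of \<open>X\<close>, listed in increasing order from index \<open>0\<close>.
  The list runs through the set of distances; for a Poisson process the distances of different
  points are almost surely different, so that almost surely no multiplicities are lost.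
\<close>

primrec increasing_distances :: "'a::real_normed_vector set \<Rightarrow> nat \<Rightarrow> real" where
  "increasing_distances X 0 = Inf (norm ` X)"
| "increasing_distances X (Suc k) = Inf {d \<in> norm ` X. increasing_distances X k < d}"

definition kth_nearest_distance :: "'a::real_normed_vector set \<Rightarrow> nat \<Rightarrow> real" where
  "kth_nearest_distance X k = increasing_distances X (k - 1)"

text \<open>
  Sanity checks: for an infinite locally finite set the enumeration is strictly increasing and
  exhausts the distances; if the distances of different points are different, the \<open>k\<close>-th one is
  attained at the point that has exactly \<open>k - 1\<close> points strictly closer to the origin.
\<close>

lemma
  fixes X :: "'a::real_normed_vector set"
  assumes fin: "\<And>B. bounded B \<Longrightarrow> finite (X \<inter> B)" and inf: "infinite X"
  shows increasing_distances_strict_mono: "strict_mono (increasing_distances X)"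
    and increasing_distances_range: "range (increasing_distances X) = norm ` X"
proof -
  let ?D = "norm ` X" and ?f = "increasing_distances X"
  have fin_le: "finite {d \<in> ?D. d \<le> r}" for r
  proof -
    have "{d \<in> ?D. d \<le> r} = norm ` (X \<inter> cball 0 r)" by auto
    then show ?thesis using fin[of "cball 0 r"] by simp
  qed
  have infD: "infinite ?D"
  proof
    assume "finite ?D"
    then obtain b where "\<And>d. d \<in> ?D \<Longrightarrow> d \<le> b"
      by (meson bdd_above.unfold bdd_above_finite)
    then have "X \<inter> cball 0 b = X" by auto
    then show False using fin[of "cball 0 b"] inf by simp
  qed
  have least: "Inf S \<in> S \<and> (\<forall>d\<in>S. Inf S \<le> d)" if S: "S \<subseteq> ?D" "S \<noteq> {}" for S
  proof -
    obtain s where s: "s \<in> S" using S by auto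
    have f: "finite {d \<in> S. d \<le> s}" using fin_le[of s] S by (auto intro: finite_subset[rotated])
    have m: "Min {d \<in> S. d \<le> s} \<in> {d \<in> S. d \<le> s}"
      by (rule Min_in[OF f]) (use s in auto)
    have le: "\<And>d. d \<in> {d \<in> S. d \<le> s} \<Longrightarrow> Min {d \<in> S. d \<le> s} \<le> d"
      by (rule Min_le[OF f])
    have low: "Min {d \<in> S. d \<le> s} \<le> d" if "d \<in> S" for d
    proof (cases "d \<le> s")
      case True then show ?thesis using le[of d] that by simp
    next
      case False then show ?thesis using m by simp
    qed
    have "Inf S = Min {d \<in> S. d \<le> s}"
      using m low by (intro cInf_eq_minimum) simp_all
    then show ?thesis using m low by simp
  qed
  have next_ne: "{d \<in> ?D. c < d} \<noteq> {}" for c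
  proof
    assume "{d \<in> ?D. c < d} = {}"
    then have "{d \<in> ?D. d \<le> c} = ?D" by force
    then show False using fin_le[of c] infD by simp
  qed
  have nxt: "?f (Suc k) \<in> ?D \<and> ?f k < ?f (Suc k) \<and> (\<forall>d\<in>?D. ?f k < d \<longrightarrow> ?f (Suc k) \<le> d)" for k
    using least[of "{d \<in> ?D. ?f k < d}"] next_ne[of "?f k"] by auto
  have zero: "?f 0 \<in> ?D \<and> (\<forall>d\<in>?D. ?f 0 \<le> d)"
    using least[of ?D] inf by auto
  show mono: "strict_mono ?f"
    using nxt by (simp add: strict_mono_Suc_iff)
  have mem: "?f k \<in> ?D" for k
    by (cases k) (use nxt zero in blast)+
  show "range ?f = ?D"
  proof
    show "range ?f \<subseteq> ?D" using mem by blast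
    show "?D \<subseteq> range ?f"
    proof
      fix d assume d: "d \<in> ?D"
      show "d \<in> range ?f"
      proof (rule ccontr)
        assume nd: "d \<notin> range ?f"
        have "?f k < d" for k
        proof (induction k)
          case 0 then show ?case using zero d nd by (metis order_le_less rangeI)
        next
          case (Suc k) then show ?case using nxt[of k] d nd by (metis order_le_less rangeI)
        qed
        then have "range ?f \<subseteq> {e \<in> ?D. e \<le> d}" using mem by (auto intro: less_imp_le)
        then have "finite (range ?f)" using fin_le finite_subset by blast
        moreover have "inj ?f" using mono by (rule strict_mono_imp_inj_on)
        ultimately show False using finite_imageD by blast
      qed
    qed
  qed
qed

lemma kth_nearest_distance_attained:
  fixes X :: "'a::real_normed_vector set"
  assumes "\<And>B. bounded B \<Longrightarrow> finite (X \<inter> B)" "infinite X" "inj_on norm X" "k \<ge> 1"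
  shows "\<exists>!x. x \<in> X \<and> norm x = kth_nearest_distance X k"
    and "x \<in> X \<Longrightarrow> norm x = kth_nearest_distance X k \<Longrightarrow> card {y \<in> X. norm y < norm x} = k - 1"
proof -
  let ?f = "increasing_distances X"
  have mono: "strict_mono ?f"
    by (rule increasing_distances_strict_mono[OF assms(1,2)])
  have range: "range ?f = norm ` X"
    by (rule increasing_distances_range[OF assms(1,2)])
  have "kth_nearest_distance X k \<in> norm ` X"
    using range unfolding kth_nearest_distance_def by blast
  then show "\<exists>!x. x \<in> X \<and> norm x = kth_nearest_distance X k"
    using assms(3) by (auto simp: inj_on_def)
  assume x: "x \<in> X" "norm x = kth_nearest_distance X k"
  have "norm ` {y \<in> X. norm y < norm x} = ?f ` {..<k - 1}"
  proof -
    have "norm ` {y \<in> X. norm y < norm x} = {d \<in> range ?f. d < ?f (k - 1)}"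
      using x unfolding range kth_nearest_distance_def by auto
    also have "\<dots> = ?f ` {..<k - 1}"
      using mono by (auto simp: strict_mono_less)
    finally show ?thesis .
  qed
  moreover have "inj_on norm {y \<in> X. norm y < norm x}"
    using assms(3) by (rule inj_on_subset) auto
  moreover have "inj_on ?f {..<k - 1}"
    by (rule inj_on_subset[OF strict_mono_imp_inj_on[OF mono] subset_UNIV])
  ultimately show "card {y \<in> X. norm y < norm x} = k - 1"
    using card_image[of norm "{y \<in> X. norm y < norm x}"] card_image[of ?f "{..<k - 1}"] by simp
qed

text \<open>
  The distribution \<open>\<Gamma>(k, 1)\<close> with integer shape \<open>k \<ge> 1\<close> is the Erlang distribution, whose first
  parameter in the library is the exponent \<open>k - 1\<close> rather than the shape, and whose second one
  is the rate, i.e. the reciprocal of the scale.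
\<close>

definition gamma_density :: "nat \<Rightarrow> real \<Rightarrow> real" where
  "gamma_density k = erlang_density (k - 1) 1"

lemma gamma_density_eq:
  "gamma_density k y = (if y < 0 then 0 else y ^ (k - 1) / fact (k - 1) * exp (- y))"
  by (simp add: gamma_density_def erlang_density_def)

end

theory Submission
  imports Defs
begin

text \<open>
  Almost surely the process is infinite and different points have different distances, so that
  \<open>R\<^sub>k \<le> r\<close> holds iff at least \<open>k\<close> points lie in the closed ball of radius \<open>r\<close>. The number of these
  points is Poisson with the rate \<open>a = \<Lambda> * vol (ball r)\<close>, and the probability that it is at least \<open>k\<close>
  is the value at \<open>a\<close> of the Erlang distribution function.
\<close>

section \<open>Measurability of the ordered distances\<close>

text \<open>By local finiteness \<open>card\<close> vanishes only on an empty intersection, never as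
  the default value for an infinite set, so the count decides the event.\<close>

lemma (in poisson_point_process) hit_measurable:
  assumes "B \<in> sets borel" "bounded B"
  shows "Measurable.pred M (\<lambda>\<omega>. \<Phi> \<omega> \<inter> B \<noteq> {})"
proof -
  have [measurable]: "(\<lambda>\<omega>. card (\<Phi> \<omega> \<inter> B)) \<in> measurable M (count_space UNIV)"
    using assms by (rule count_measurable)
  have "Measurable.pred M (\<lambda>\<omega>. card (\<Phi> \<omega> \<inter> B) \<noteq> 0)"
    by measurable
  also have "?this \<longleftrightarrow> ?thesis"
    using locally_finite[OF _ assms(2)] by (intro measurable_cong) (simp add: card_eq_0_iff)
  finally show ?thesis .
qed

text \<open>
  On the exceptional outcomes where no distance exceeds \<open>t\<close>, the infimum is the unspecified constant
  \<open>Inf {}\<close>; \<open>H a \<omega>\<close> below expresses by countably many counts that some distance lies in \<open>(t, a)\<close>.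
\<close>

lemma (in poisson_point_process) Inf_norm_greater_measurable:
  fixes t :: "'w \<Rightarrow> real"
  assumes [measurable]: "t \<in> borel_measurable M"
  shows "(\<lambda>\<omega>. Inf {d \<in> norm ` \<Phi> \<omega>. t \<omega> < d}) \<in> borel_measurable M"
proof -
  let ?S = "\<lambda>\<omega>. {d \<in> norm ` \<Phi> \<omega>. t \<omega> < d}"
  \<comment> \<open>A rational \<open>q\<close> between \<open>t \<omega>\<close> and the distance
    replaces the random endpoint, so that each counted shell is a fixed set.\<close>
  define H where "H a \<omega> \<longleftrightarrow> (\<exists>q::rat. t \<omega> < of_rat q \<and> \<Phi> \<omega> \<inter> {x. of_rat q \<le> norm x \<and> norm x < a} \<noteq> {})" for a \<omega>
  have H_iff: "H a \<omega> \<longleftrightarrow> (\<exists>d\<in>?S \<omega>. d < a)" for a \<omega>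
  proof
    assume "\<exists>d\<in>?S \<omega>. d < a"
    then obtain x where x: "x \<in> \<Phi> \<omega>" "t \<omega> < norm x" "norm x < a"
      by auto
    then obtain q where "t \<omega> < of_rat q" "of_rat q < norm x"
      using of_rat_dense by blast
    then show "H a \<omega>"
      using x unfolding H_def by (intro exI[of _ q]) auto
  qed (fastforce simp: H_def)
  have bdd: "bounded {x::'a. of_rat q \<le> norm x \<and> norm x < a}" for q a
    by (rule bounded_subset[OF bounded_ball[of 0 a]]) auto
  have "Measurable.pred M (\<lambda>\<omega>. t \<omega> < of_rat q \<and>
    \<Phi> \<omega> \<inter> {x. of_rat q \<le> norm x \<and> norm x < a} \<noteq> {})" for q a
  proof (rule pred_intros_logic(3))
    show "Measurable.pred M (\<lambda>\<omega>. \<Phi> \<omega> \<inter> {x. of_rat q \<le> norm x \<and> norm x < a} \<noteq> {})"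
      by (intro hit_measurable bdd) measurable
  qed measurable
  then have [measurable]: "Measurable.pred M (H a)" for a
    unfolding H_def by (rule pred_intros_countable)
  have "Inf (?S \<omega>) < a \<longleftrightarrow> H a \<omega> \<or> (\<forall>m::nat. \<not> H (real m) \<omega>) \<and> Inf ({}::real set) < a" for a \<omega>
  proof (cases "?S \<omega> = {}")
    case True
    then show ?thesis unfolding H_iff True by simp
  next
    case False
    have "bdd_below (?S \<omega>)"
      by (rule bdd_belowI[of _ "t \<omega>"]) auto
    then have "Inf (?S \<omega>) < a \<longleftrightarrow> (\<exists>d\<in>?S \<omega>. d < a)"
      using False by (intro cInf_less_iff)
    moreover have "\<exists>m::nat. \<exists>d\<in>?S \<omega>. d < real m"
      using False reals_Archimedean2 by blast
    ultimately show ?thesis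
      unfolding H_iff by blast
  qed
  then have "{\<omega> \<in> space M. Inf (?S \<omega>) < a} =
    {\<omega> \<in> space M. H a \<omega> \<or> (\<forall>m::nat. \<not> H (real m) \<omega>) \<and> Inf ({}::real set) < a}" for a
    by simp
  moreover have "{\<omega> \<in> space M. H a \<omega> \<or> (\<forall>m::nat. \<not> H (real m) \<omega>) \<and> Inf ({}::real set) < a} \<in> sets M" for a
    by measurable
  ultimately show ?thesis
    unfolding borel_measurable_iff_less by simp
qed

lemma (in poisson_point_process) increasing_distances_measurable:
  "(\<lambda>\<omega>. increasing_distances (\<Phi> \<omega>) k) \<in> borel_measurable M"
proof (induction k)
  case 0
  \<comment> \<open>The threshold -1 lies below every norm, which gives the first distance the same
    form as its successors.\<close>
  have "{d \<in> norm ` \<Phi> \<omega>. - 1 < d} = norm ` \<Phi> \<omega>" for \<omega>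
    by (auto intro: less_le_trans[OF _ norm_ge_zero])
  then show ?case
    using Inf_norm_greater_measurable[of "\<lambda>_. - 1"] by simp
next
  case (Suc k)
  then show ?case
    using Inf_norm_greater_measurable by simp
qed

section \<open>Tail probabilities of the counts\<close>

lemma (in poisson_point_process) prob_card_ge:
  assumes "B \<in> sets borel" "bounded B"
  shows "prob {\<omega> \<in> space M. k \<le> card (\<Phi> \<omega> \<inter> B)} =
    1 - (\<Sum>n<k. (\<Lambda> * measure lborel B) ^ n / fact n * exp (- (\<Lambda> * measure lborel B)))"
proof -
  have [measurable]: "(\<lambda>\<omega>. card (\<Phi> \<omega> \<inter> B)) \<in> measurable M (count_space UNIV)"
    using assms by (rule count_measurable)
  have "prob {\<omega> \<in> space M. \<not> k \<le> card (\<Phi> \<omega> \<inter> B)} =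
    prob (\<Union>n<k. {\<omega> \<in> space M. card (\<Phi> \<omega> \<inter> B) = n})"
    by (rule arg_cong[where f = prob]) auto
  also have "\<dots> = (\<Sum>n<k. prob {\<omega> \<in> space M. card (\<Phi> \<omega> \<inter> B) = n})"
    by (intro finite_measure_finite_Union) (auto simp: disjoint_family_on_def)
  finally show ?thesis
    using prob_neg[of "\<lambda>\<omega>. k \<le> card (\<Phi> \<omega> \<inter> B)"] by (simp add: count_poisson[OF assms])
qed

text \<open>Multiplying \<open>1 - m \<le> exp (- m)\<close> by \<open>1 + m\<close> yields the
  bound. Being quadratic in the volume, it stays small when summed over many small sets.\<close>

lemma (in poisson_point_process) prob_card_ge_2:
  assumes "B \<in> sets borel" "bounded B"
  shows "prob {\<omega> \<in> space M. 2 \<le> card (\<Phi> \<omega> \<inter> B)} \<le> (\<Lambda> * measure lborel B)\<^sup>2"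
proof -
  define m where "m = \<Lambda> * measure lborel B"
  have "m \<ge> 0"
    using intensity_pos by (simp add: m_def)
  have "(1 - m) * (1 + m) \<le> exp (- m) * (1 + m)"
    using exp_ge_add_one_self[of "- m"] \<open>m \<ge> 0\<close> by (intro mult_right_mono) auto
  then have "1 - (exp (- m) + m * exp (- m)) \<le> m\<^sup>2"
    by (simp add: algebra_simps power2_eq_square)
  then show ?thesis
    unfolding prob_card_ge[OF assms] m_def by (simp add: eval_nat_numeral)
qed

section \<open>Ball volumes and almost surely distinct distances\<close>

text \<open>Describing balls by the \<open>DIM('a)\<close>-th power of the norm makes the volume
  linear in the parameter, so equal steps in \<open>t\<close> give shells of equal volume.\<close>

lemma measure_norm_power_le:
  assumes "t \<ge> 0"
  shows "{x::'a::euclidean_space. norm x ^ DIM('a) \<le> t} = cball 0 (root DIM('a) t)"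
    and "measure lborel {x::'a. norm x ^ DIM('a) \<le> t} = unit_ball_vol DIM('a) * t"
proof -
  have "norm x ^ DIM('a) \<le> t \<longleftrightarrow> norm x \<le> root DIM('a) t" for x :: 'a
  proof -
    have "norm x \<le> root DIM('a) t \<longleftrightarrow> root DIM('a) (norm x ^ DIM('a)) \<le> root DIM('a) t"
      by (simp only: real_root_power_cancel[OF DIM_positive norm_ge_zero])
    then show ?thesis
      by (simp only: real_root_le_iff[OF DIM_positive])
  qed
  then show eq: "{x::'a. norm x ^ DIM('a) \<le> t} = cball 0 (root DIM('a) t)"
    unfolding set_eq_iff mem_Collect_eq mem_cball_0 by blast
  show "measure lborel {x::'a. norm x ^ DIM('a) \<le> t} = unit_ball_vol DIM('a) * t"
    unfolding eq using assms by (subst content_cball) (simp_all add: real_root_pow_pos2)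
qed

text \<open>
  The powers \<open>norm x ^ DIM('a)\<close> slice a ball into \<open>n\<close> shells of equal volume. If two points have the
  same distance, some shell contains two points, which has probability at most \<open>n * O(1 / n\<^sup>2)\<close>.
\<close>

lemma (in poisson_point_process) AE_inj_on_norm_bounded:
  assumes "r \<ge> 0"
  shows "AE \<omega> in M. inj_on norm (\<Phi> \<omega> \<inter> {x. norm x ^ DIM('a) \<le> r})"
proof -
  define A where "A n i = {x::'a. r * real i / real n < norm x ^ DIM('a) \<and>
    norm x ^ DIM('a) \<le> r * real (Suc i) / real n}" for n i
  define E where "E n = (\<Union>i<n. {\<omega> \<in> space M. 2 \<le> card (\<Phi> \<omega> \<inter> A n i)})" for n
  \<comment> \<open>\<open>c\<close> is the Poisson rate of the whole ball; each of
    \<open>n > 0\<close> shells has rate \<open>c / real n\<close>.\<close>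
  define c where "c = \<Lambda> * unit_ball_vol DIM('a) * r"
  have ball: "bounded {x::'a. norm x ^ DIM('a) \<le> t}" "{x::'a. norm x ^ DIM('a) \<le> t} \<in> fmeasurable lborel"
    if "t \<ge> 0" for t
    unfolding measure_norm_power_le(1)[OF that] by (auto intro!: fmeasurableI emeasure_bounded_finite)
  have nonneg: "r * real i / real n \<ge> 0" for i n
    using assms by simp
  have A_diff: "A n i = {x. norm x ^ DIM('a) \<le> r * real (Suc i) / real n} -
    {x. norm x ^ DIM('a) \<le> r * real i / real n}" for n i
    unfolding A_def by auto
  have A_bdd: "bounded (A n i)" for n i
    unfolding A_diff using ball(1)[OF nonneg] by (rule bounded_diff)
  have A_borel[measurable]: "A n i \<in> sets borel" for n i
    unfolding A_def by measurable
  have A_vol: "\<Lambda> * measure lborel (A n i) = c / real n" if "n > 0" for n i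
  proof -
    have mono: "r * real i / real n \<le> r * real (Suc i) / real n"
      using assms by (intro divide_right_mono mult_left_mono) auto
    have "measure lborel (A n i) = unit_ball_vol DIM('a) * (r * real (Suc i) / real n) -
      unit_ball_vol DIM('a) * (r * real i / real n)"
      unfolding A_diff measure_norm_power_le(2)[OF nonneg, symmetric]
      using mono by (intro measurable_measure_Diff fmeasurableD ball(2) nonneg) (auto elim: order_trans)
    then show ?thesis
      by (simp add: c_def field_simps add_divide_distrib)
  qed
  have [measurable]: "(\<lambda>\<omega>. card (\<Phi> \<omega> \<inter> A n i)) \<in> measurable M (count_space UNIV)" for n i
    using A_borel A_bdd by (rule count_measurable)
  have [measurable]: "E n \<in> sets M" for n
    unfolding E_def by measurable
  have E_small: "prob (E n) \<le> c\<^sup>2 / real n" if "n > 0" for n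
  proof -
    have "prob (E n) \<le> (\<Sum>i<n. prob {\<omega> \<in> space M. 2 \<le> card (\<Phi> \<omega> \<inter> A n i)})"
      unfolding E_def by (intro finite_measure_subadditive_finite) auto
    also have "\<dots> \<le> (\<Sum>i<n. (c / real n)\<^sup>2)"
      using prob_card_ge_2[OF A_borel A_bdd] A_vol[OF that] by (intro sum_mono) metis
    also have "\<dots> = c\<^sup>2 / real n"
      using that by (simp add: power2_eq_square)
    finally show ?thesis .
  qed
  \<comment> \<open>The index starts at one because \<open>E 0\<close> is an empty union and would
    make the intersection empty.\<close>
  have "prob (\<Inter>n. E (Suc n)) \<le> 0"
  proof (rule LIMSEQ_le_const)
    show "(\<lambda>n. c\<^sup>2 / real (Suc n)) \<longlonglongrightarrow> 0"
      by (rule LIMSEQ_Suc[OF lim_const_over_n])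
    have "prob (\<Inter>n. E (Suc n)) \<le> c\<^sup>2 / real (Suc m)" for m
      using E_small[of "Suc m"] finite_measure_mono[of "\<Inter>n. E (Suc n)" "E (Suc m)"] by fastforce
    then show "\<exists>N. \<forall>n\<ge>N. prob (\<Inter>n. E (Suc n)) \<le> c\<^sup>2 / real (Suc n)"
      by blast
  qed
  then have null: "(\<Inter>n. E (Suc n)) \<in> null_sets M"
    by (intro null_setsI) (simp_all add: emeasure_eq_measure measure_le_0_iff)
  have "\<omega> \<in> E n" if \<omega>: "\<omega> \<in> space M" and n: "n > 0"
    and notinj: "\<not> inj_on norm (\<Phi> \<omega> \<inter> {x. norm x ^ DIM('a) \<le> r})" for \<omega> n
  proof -
    obtain x y where xy: "x \<in> \<Phi> \<omega>" "y \<in> \<Phi> \<omega>" "norm x = norm y" "x \<noteq> y" "norm x ^ DIM('a) \<le> r"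
      using notinj by (auto simp: inj_on_def)
    let ?v = "norm x ^ DIM('a)"
    \<comment> \<open>Distinct points of equal norm cannot be the origin, the only point of the ball
      that the shells, open at their inner radius, leave out.\<close>
    have "norm x > 0"
      using xy(3,4) by auto
    then have v: "?v > 0"
      by simp
    then have r: "r > 0"
      using xy(5) by simp
    \<comment> \<open>Rounding up matches the shells \<open>A n i\<close>, which contain their outer
      but not their inner sphere; the shell index is \<open>j - 1\<close>.\<close>
    define j where "j = nat \<lceil>?v * real n / r\<rceil>"
    have pos: "?v * real n / r > 0"
      using v r n by simp
    then have j: "real j - 1 < ?v * real n / r" "?v * real n / r \<le> real j"
      unfolding j_def by linarith+
    then have "j > 0"
      using pos by (cases j) auto
    then obtain i where i: "j = Suc i"
      by (cases j) auto
    have "?v * real n / r \<le> real n"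
      using r n xy(5) by (simp add: field_simps)
    then have "i < n"
      using j i by simp
    have "x \<in> A n i" "y \<in> A n i"
      using j r n xy(3) unfolding A_def i by (auto simp: field_simps)
    then have "card {x, y} \<le> card (\<Phi> \<omega> \<inter> A n i)"
      using xy by (intro card_mono locally_finite[OF \<omega> A_bdd]) auto
    then have "2 \<le> card (\<Phi> \<omega> \<inter> A n i)"
      using \<open>x \<noteq> y\<close> by simp
    then show ?thesis
      using \<omega> \<open>i < n\<close> unfolding E_def by blast
  qed
  then show ?thesis
    by (intro AE_I'[OF null]) auto
qed

text \<open>Two points of equal norm lie in a common ball of a countable exhaustion.\<close>

lemma (in poisson_point_process) AE_inj_on_norm: "AE \<omega> in M. inj_on norm (\<Phi> \<omega>)"
proof -
  have "AE \<omega> in M. \<forall>m::nat. inj_on norm (\<Phi> \<omega> \<inter> {x. norm x ^ DIM('a) \<le> real m})"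
    by (simp add: AE_all_countable AE_inj_on_norm_bounded)
  then show ?thesis
  proof eventually_elim
    case (elim \<omega>)
    show ?case
    proof (rule inj_onI)
      fix x y assume xy: "x \<in> \<Phi> \<omega>" "y \<in> \<Phi> \<omega>" "norm x = norm y"
      obtain m :: nat where "norm x ^ DIM('a) \<le> real m"
        using real_arch_simple by blast
      then show "x = y"
        using elim xy by (auto dest!: spec[of _ m] simp: inj_on_def)
    qed
  qed
qed

section \<open>Almost surely infinitely many points\<close>

text \<open>If there were only \<open>k\<close> points, all sufficiently large balls would contain
  exactly \<open>k\<close>. This is a null event, since the Poisson probability of a fixed
  \<open>k\<close> tends to 0 as the rate grows.\<close>

lemma (in poisson_point_process) AE_infinite: "AE \<omega> in M. infinite (\<Phi> \<omega>)"
proof -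
  define E where "E k r = {\<omega> \<in> space M. card (\<Phi> \<omega> \<inter> cball 0 (root DIM('a) r)) = k}" for k r
  have [measurable]: "E k r \<in> sets M" for k r
    using measurable_sets[OF count_measurable[of "cball 0 (root DIM('a) r)"], of "{k}"]
    unfolding E_def vimage_def by (simp add: Int_def conj_commute)
  have null: "(\<Inter>n::nat. E k (real (m + n))) \<in> null_sets M" for k m :: nat
  proof -
    define c where "c = \<Lambda> * unit_ball_vol DIM('a)"
    have "c > 0"
      using intensity_pos by (simp add: c_def)
    have E: "prob (E k r) = (c * r) ^ k / fact k * exp (- (c * r))" if "r \<ge> 0" for r
      using that measure_norm_power_le[OF that, where 'a = 'a]
      unfolding E_def c_def by (subst count_poisson) (auto simp: mult.assoc)
    have "prob (\<Inter>n::nat. E k (real (m + n))) \<le> 0"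
    proof (rule LIMSEQ_le_const)
      have "((\<lambda>x::real. x ^ k / exp x / fact k) \<longlongrightarrow> 0 / fact k) at_top"
        by (intro tendsto_intros tendsto_power_div_exp_0) auto
      moreover have "filterlim (\<lambda>n. c * real (m + n)) at_top sequentially"
        using \<open>c > 0\<close>
        by (intro filterlim_tendsto_pos_mult_at_top[OF tendsto_const]
            filterlim_compose[OF filterlim_real_sequentially] filterlim_subseq) (auto simp: strict_mono_def)
      ultimately have "(\<lambda>n. (c * real (m + n)) ^ k / exp (c * real (m + n)) / fact k) \<longlonglongrightarrow> 0 / fact k"
        by (rule filterlim_compose)
      then show "(\<lambda>n. (c * real (m + n)) ^ k / fact k * exp (- (c * real (m + n)))) \<longlonglongrightarrow> 0"
        by (simp add: exp_minus divide_inverse mult_ac del: of_nat_add)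
      have "prob (\<Inter>n::nat. E k (real (m + n))) \<le> prob (E k (real (m + n)))" for n
        by (rule finite_measure_mono) auto
      then show "\<exists>N. \<forall>n\<ge>N. prob (\<Inter>n. E k (real (m + n))) \<le>
        (c * real (m + n)) ^ k / fact k * exp (- (c * real (m + n)))"
        using E by (metis of_nat_0_le_iff)
    qed
    then show ?thesis
      by (intro null_setsI) (simp_all add: emeasure_eq_measure measure_le_0_iff)
  qed
  have "AE \<omega> in M. \<omega> \<notin> (\<Inter>n::nat. E k (real (m + n)))" for k m :: nat
    using null by (rule AE_not_in)
  then have "AE \<omega> in M. \<forall>k m :: nat. \<omega> \<notin> (\<Inter>n::nat. E k (real (m + n)))"
    unfolding AE_all_countable by (intro allI)
  then show ?thesis
    using AE_space
  proof eventually_elim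
    case (elim \<omega>)
    show ?case
    proof
      assume "finite (\<Phi> \<omega>)"
      then have "bdd_above ((\<lambda>x. norm x ^ DIM('a)) ` \<Phi> \<omega>)"
        by (intro bdd_above_finite finite_imageI)
      then obtain b where b: "\<And>x. x \<in> \<Phi> \<omega> \<Longrightarrow> norm x ^ DIM('a) \<le> b"
        unfolding bdd_above_def by auto
      obtain m :: nat where m: "b \<le> real m"
        using real_arch_simple by blast
      have "x \<in> cball 0 (root DIM('a) (real (m + n)))" if "x \<in> \<Phi> \<omega>" for x n
      proof -
        have "norm x ^ DIM('a) \<le> real (m + n)"
          using b[OF that] m by simp
        then show ?thesis
          unfolding measure_norm_power_le(1)[OF of_nat_0_le_iff, symmetric] by simp
      qed
      then have "\<Phi> \<omega> \<inter> cball 0 (root DIM('a) (real (m + n))) = \<Phi> \<omega>" for n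
        by blast
      then have "\<omega> \<in> (\<Inter>n::nat. E (card (\<Phi> \<omega>)) (real (m + n)))"
        using elim(2) unfolding E_def by simp
      then show False
        using elim(1) by blast
    qed
  qed
qed

section \<open>Distribution of the \<open>k\<close>-th distance\<close>

text \<open>Injectivity of the norm lets points in the ball be counted by the indices
  \<open>j\<close> with \<open>increasing_distances X j \<le> r\<close>; by monotonicity these form
  an initial segment of the naturals.\<close>

lemma kth_nearest_distance_le_iff:
  fixes X :: "'a::real_normed_vector set"
  assumes fin: "\<And>B. bounded B \<Longrightarrow> finite (X \<inter> B)" and inf: "infinite X"
    and inj: "inj_on norm X" and "k \<ge> 1"
  shows "kth_nearest_distance X k \<le> r \<longleftrightarrow> k \<le> card (X \<inter> cball 0 r)"
proof -
  let ?f = "increasing_distances X"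
  have mono: "strict_mono ?f"
    using fin inf by (rule increasing_distances_strict_mono)
  have range: "range ?f = norm ` X"
    using fin inf by (rule increasing_distances_range)
  have "?f ` {j. ?f j \<le> r} = norm ` (X \<inter> cball 0 r)"
  proof -
    have "?f ` {j. ?f j \<le> r} = {d \<in> range ?f. d \<le> r}"
      by auto
    also have "\<dots> = norm ` (X \<inter> cball 0 r)"
      unfolding range by auto
    finally show ?thesis .
  qed
  moreover have "inj_on norm (X \<inter> cball 0 r)"
    using inj by (rule inj_on_subset) auto
  moreover have "inj_on ?f {j. ?f j \<le> r}"
    by (rule inj_on_subset[OF strict_mono_imp_inj_on[OF mono] subset_UNIV])
  ultimately have card: "card {j. ?f j \<le> r} = card (X \<inter> cball 0 r)" and fin_J: "finite {j. ?f j \<le> r}"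
    using fin[of "cball 0 r"] by (metis bounded_cball card_image, metis bounded_cball finite_imageI finite_image_iff)
  show ?thesis
  proof
    assume "kth_nearest_distance X k \<le> r"
    then have "{..<k} \<subseteq> {j. ?f j \<le> r}"
      by (auto simp: kth_nearest_distance_def strict_mono_less_eq[OF mono] elim: order_trans[rotated])
    then show "k \<le> card (X \<inter> cball 0 r)"
      using card_mono[OF fin_J, of "{..<k}"] card by simp
  next
    assume le: "k \<le> card (X \<inter> cball 0 r)"
    show "kth_nearest_distance X k \<le> r"
    proof (rule ccontr)
      assume "\<not> kth_nearest_distance X k \<le> r"
      \<comment> \<open>Indices start at 0, so the \<open>k\<close>-th distance has index
        \<open>k - 1\<close>, and only smaller indices can remain.\<close>
      then have "{j. ?f j \<le> r} \<subseteq> {..<k - 1}"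
        by (auto simp: kth_nearest_distance_def simp flip: strict_mono_less[OF mono])
      then have "card {j. ?f j \<le> r} \<le> k - 1"
        using card_mono[of "{..<k - 1}"] by simp
      then show False
        using le card \<open>k \<ge> 1\<close> by simp
    qed
  qed
qed

text \<open>In any dimension, the variable is almost surely the intensity times the volume of the
  ball reaching to the \<open>k\<close>-th nearest point. Its law is identified through the Erlang
  distribution function.\<close>

lemma (in poisson_point_process) distributed_kth_nearest_distance:
  assumes "k \<ge> 1"
  shows "distributed M lborel
    (\<lambda>\<omega>. \<Lambda> * unit_ball_vol DIM('a) * kth_nearest_distance (\<Phi> \<omega>) k ^ DIM('a)) (erlang_density (k - 1) 1)"
proof -
  define c where "c = \<Lambda> * unit_ball_vol DIM('a)"
  have "c > 0"
    using intensity_pos by (simp add: c_def)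
  have [measurable]: "(\<lambda>\<omega>. kth_nearest_distance (\<Phi> \<omega>) k) \<in> borel_measurable M"
    unfolding kth_nearest_distance_def by (rule increasing_distances_measurable)
  have "\<P>(\<omega> in M. c * kth_nearest_distance (\<Phi> \<omega>) k ^ DIM('a) \<le> a) = erlang_CDF (k - 1) 1 a"
    if "a \<ge> 0" for a
  proof -
    \<comment> \<open>The radius at which the ball has Poisson rate exactly
      \<open>a\<close>.\<close>
    define r where "r = root DIM('a) (a / c)"
    have ac: "a / c \<ge> 0"
      using that \<open>c > 0\<close> by simp
    note ball = measure_norm_power_le[OF ac, where 'a = 'a, folded r_def]
    have "\<Lambda> * measure lborel (cball (0::'a) r) = c * (a / c)"
      using ball(2) unfolding ball(1) by (simp only: c_def mult.assoc)
    then have vol: "\<Lambda> * measure lborel (cball (0::'a) r) = a"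
      using \<open>c > 0\<close> by simp
    have [measurable]: "(\<lambda>\<omega>. card (\<Phi> \<omega> \<inter> cball 0 r)) \<in> measurable M (count_space UNIV)"
      by (rule count_measurable) auto
    have "AE \<omega> in M. c * kth_nearest_distance (\<Phi> \<omega>) k ^ DIM('a) \<le> a \<longleftrightarrow> k \<le> card (\<Phi> \<omega> \<inter> cball 0 r)"
      using AE_inj_on_norm AE_infinite AE_space
    proof eventually_elim
      case (elim \<omega>)
      note fin = locally_finite[OF elim(3)]
      let ?d = "kth_nearest_distance (\<Phi> \<omega>) k"
      \<comment> \<open>A point realising \<open>?d\<close> as its norm lets the description of the
        ball by powers of norms be applied to \<open>?d\<close>.\<close>
      have "\<exists>!x. x \<in> \<Phi> \<omega> \<and> norm x = ?d"
        using elim assms by (intro kth_nearest_distance_attained(1) fin)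
      then obtain x :: 'a where x: "norm x = ?d"
        by blast
      have "c * ?d ^ DIM('a) \<le> a \<longleftrightarrow> x \<in> {x. norm x ^ DIM('a) \<le> a / c}"
        using \<open>c > 0\<close> x by (simp add: field_simps)
      also have "\<dots> \<longleftrightarrow> ?d \<le> r"
        unfolding ball(1) using x by simp
      also have "\<dots> \<longleftrightarrow> k \<le> card (\<Phi> \<omega> \<inter> cball 0 r)"
        using elim assms by (intro kth_nearest_distance_le_iff fin)
      finally show ?case .
    qed
    then have "\<P>(\<omega> in M. c * kth_nearest_distance (\<Phi> \<omega>) k ^ DIM('a) \<le> a) =
      \<P>(\<omega> in M. k \<le> card (\<Phi> \<omega> \<inter> cball 0 r))"
      by (intro prob_eq_AE) measurable
    also have "\<dots> = 1 - (\<Sum>n<k. a ^ n / fact n * exp (- a))"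
      by (simp add: prob_card_ge vol)
    \<comment> \<open>\<open>erlang_CDF\<close> sums up to and including its first parameter, here
      \<open>k - 1\<close>.\<close>
    also have "{..<k} = {..k - 1}"
      using assms by auto
    finally show ?thesis
      using that by (simp add: erlang_CDF_def)
  qed
  then show ?thesis
    by (simp add: erlang_distributed_iff c_def)
qed

theorem lemma2:
  fixes M :: "'w measure" and \<Phi> :: "'w \<Rightarrow> (real ^ 2) set" and \<Lambda> :: real and k :: nat
  assumes "\<Lambda> > 0"
    and "poisson_point_process M \<Phi> \<Lambda>"
    and "k \<ge> 1"
  shows "distributed M lborel (\<lambda>\<omega>. \<Lambda> * pi * (kth_nearest_distance (\<Phi> \<omega>) k)\<^sup>2)
           (\<lambda>y. ennreal (gamma_density k y))"
  \<comment> \<open>The plane is the case of dimension 2, where the unit ball has area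
    \<open>pi\<close>.\<close>
  using poisson_point_process.distributed_kth_nearest_distance[OF assms(2,3)]
  by (simp add: gamma_density_def unit_ball_vol_2)

end
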